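(* Let $K$ be a field, $d,n\ge 1$. Every ideal $I\subseteq K[X]$ corresponding to a point of the multigraded Hilbert scheme $H_{d,n}$ is a radical ideal.
   Context: Let $X=(x_{ij})$ be a $d\times n$ matrix of indeterminates and $K[X]$ the polynomial ring in these $dn$ variables, $\mathbb{Z}^n$-graded by column degree: $\deg(x_{ij})=e_j$ (the $j$-th standard basis vector). The multigraded Hilbert scheme $H_{d,n}$ parametrizes all $\mathbb{Z}^n$-homogeneous ideals $I\subseteq K[X]$ such that for every $u=(u_1,\dots,u_n)\in\mathbb{N}^n$, $\dim_K (K[X]/I)_u=\binom{u_1+\cdots+u_n+d-1}{d-1}$. (The ideal $I_2(X)$ of $2\times 2$ minors of $X$ is such an ideal.) *)

theory Defs
  imports Complex_Main "HOL-Library.Poly_Mapping"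
begin

text \<open>Variables x_ij are indexed by pairs (i,j) with i < d (row) and j < n (column), 0-based.
  Monomials are finitely supported exponent vectors; polynomials over K are finitely
  supported maps from monomials to coefficients (this is the monoid ring, with the
  ring structure supplied by HOL-Library.Poly_Mapping).\<close>

type_synonym monom = "(nat \<times> nat) \<Rightarrow>\<^sub>0 nat"
type_synonym 'a mpoly = "monom \<Rightarrow>\<^sub>0 'a"

definition polyring :: "nat \<Rightarrow> nat \<Rightarrow> ('a::field) mpoly set" where
  "polyring d n = {p :: 'a mpoly. \<forall>m \<in> Poly_Mapping.keys p. \<forall>v \<in> Poly_Mapping.keys m. fst v < d \<and> snd v < n}"

definition pscale :: "'a::field \<Rightarrow> 'a mpoly \<Rightarrow> 'a mpoly" where
  "pscale c p = Poly_Mapping.map (\<lambda>x. c * x) p"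

text \<open>Column degree of a monomial: the j-th component of its Z^n-degree.\<close>
definition coldeg :: "monom \<Rightarrow> nat \<Rightarrow> nat" where
  "coldeg m j = (\<Sum>v \<in> {v \<in> Poly_Mapping.keys m. snd v = j}. Poly_Mapping.lookup m v)"

definition hcomp :: "nat \<Rightarrow> (nat \<Rightarrow> nat) \<Rightarrow> ('a::field) mpoly \<Rightarrow> 'a mpoly" where
  "hcomp n u p = Abs_poly_mapping
     (\<lambda>m. if (\<forall>j<n. coldeg m j = u j) then Poly_Mapping.lookup p m else 0)"

definition graded_piece :: "nat \<Rightarrow> nat \<Rightarrow> (nat \<Rightarrow> nat) \<Rightarrow> ('a::field) mpoly set" where
  "graded_piece d n u = {p \<in> polyring d n. \<forall>m \<in> Poly_Mapping.keys p. \<forall>j<n. coldeg m j = u j}"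

definition is_ideal :: "nat \<Rightarrow> nat \<Rightarrow> ('a::field) mpoly set \<Rightarrow> bool" where
  "is_ideal d n I \<longleftrightarrow> I \<subseteq> polyring d n \<and> 0 \<in> I \<and>
     (\<forall>f\<in>I. \<forall>g\<in>I. f + g \<in> I) \<and>
     (\<forall>f\<in>I. \<forall>r\<in>polyring d n. r * f \<in> I)"

definition is_multihomogeneous :: "nat \<Rightarrow> ('a::field) mpoly set \<Rightarrow> bool" where
  "is_multihomogeneous n I \<longleftrightarrow> (\<forall>f\<in>I. \<forall>u. hcomp n u f \<in> I)"

text \<open>dim_K (K[X]/I)_u = dim_K K[X]_u - dim_K I_u (K[X]_u is finite-dimensional).\<close>
definition quot_dim :: "nat \<Rightarrow> nat \<Rightarrow> ('a::field) mpoly set \<Rightarrow> (nat \<Rightarrow> nat) \<Rightarrow> nat" where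
  "quot_dim d n I u = vector_space.dim pscale (graded_piece d n u :: 'a mpoly set)
                      - vector_space.dim pscale (I \<inter> graded_piece d n u)"

definition in_Hilb :: "nat \<Rightarrow> nat \<Rightarrow> ('a::field) mpoly set \<Rightarrow> bool" where
  "in_Hilb d n I \<longleftrightarrow> is_ideal d n I \<and> is_multihomogeneous n I \<and>
     (\<forall>u::nat \<Rightarrow> nat. quot_dim d n I u = ((\<Sum>j<n. u j) + d - 1) choose (d - 1))"

definition is_radical :: "nat \<Rightarrow> nat \<Rightarrow> ('a::field) mpoly set \<Rightarrow> bool" where
  "is_radical d n I \<longleftrightarrow> (\<forall>f \<in> polyring d n. \<forall>k::nat. f ^ k \<in> I \<longrightarrow> f \<in> I)"

end

theory Submission
  imports Defs "HOL-Computational_Algebra.Primes" "HOL-Library.Infinite_Set" "HOL-Library.Nat_Bijection"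
begin

text \<open>
  Passing to leading monomials for some monomial order keeps the Hilbert function, so the standard
  monomials of \<open>I\<close> form an order ideal \<open>B\<close> with \<open>D + |u| choose D\<close> members in degree \<open>u\<close>, where
  \<open>D = d - 1\<close>. It suffices that membership in \<open>B\<close> depends only on the support of a monomial: then a
  leading monomial of \<open>f\<close> lies in the initial ideal as soon as that of a power of \<open>f\<close> does, and
  \<open>f\<close> can be reduced modulo \<open>I\<close> until nothing is left.

  For every \<open>b\<close> with \<open>b_1 + ... + b_n = D\<close>, the \<open>b\<close>-th iterated difference of the Hilbert function
  is \<open>1\<close>. As \<open>B\<close> is a finite disjoint union of translated coordinate orthants, one of these
  orthants is not killed by the difference operator, which yields a set \<open>F(b)\<close> of variables with at
  least \<open>b_j + 1\<close> members in column \<open>j\<close> such that all monomials in these variables are in \<open>B\<close>.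
  Conversely, by induction on \<open>D\<close> and \<open>u\<close>, the orthants of any such family \<open>F\<close> cover at least
  \<open>D + |u| choose D\<close> monomials of degree \<open>u\<close>. So they cover \<open>B\<close>, and a union of coordinate orthants
  is determined by supports. Vectors \<open>b\<close> are encoded by words of length \<open>D\<close> in the columns, which
  makes both inductions structural.
\<close>

section \<open>Exponent vectors and column degrees\<close>

abbreviation mlookup :: "monom \<Rightarrow> nat \<times> nat \<Rightarrow> nat" where
  "mlookup \<equiv> Poly_Mapping.lookup"

abbreviation supp :: "monom \<Rightarrow> (nat \<times> nat) set" where
  "supp \<equiv> Poly_Mapping.keys"

abbreviation xvar :: "nat \<times> nat \<Rightarrow> monom" where
  "xvar v \<equiv> Poly_Mapping.single v (Suc 0)"

lemma supp_add: "supp (a + b) = supp a \<union> supp b"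
  by (auto simp: in_keys_iff lookup_add)

lemma monom_diff_add: "(\<And>v. mlookup a v \<le> mlookup b v) \<Longrightarrow> a + (b - a) = b"
  by (intro poly_mapping_eqI) (simp add: lookup_add lookup_minus)

lemma coldeg_superset:
  assumes "finite S" "supp m \<subseteq> S"
  shows "coldeg m j = (\<Sum>v \<in> {v\<in>S. snd v = j}. mlookup m v)"
  unfolding coldeg_def using assms
  by (intro sum.mono_neutral_left) (auto simp: in_keys_iff)

lemma coldeg_add: "coldeg (a + b) j = coldeg a j + coldeg b j"
proof -
  let ?S = "supp a \<union> supp b"
  have "coldeg m j = (\<Sum>v \<in> {v\<in>?S. snd v = j}. mlookup m v)" if "supp m \<subseteq> ?S" for m
    using that by (intro coldeg_superset) auto
  then show ?thesis
    by (simp add: supp_add lookup_add sum.distrib)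
qed

lemma coldeg_xvar: "coldeg (xvar v) j = (if snd v = j then 1 else 0)"
proof -
  have "coldeg (xvar v) j = (\<Sum>w \<in> {w\<in>{v}. snd w = j}. mlookup (xvar v) w)"
    by (intro coldeg_superset) auto
  also have "{w\<in>{v}. snd w = j} = (if snd v = j then {v} else {})" by auto
  finally show ?thesis by simp
qed

lemma lookup_le_coldeg: "mlookup m v \<le> coldeg m (snd v)"
proof (cases "v \<in> supp m")
  case True
  then show ?thesis unfolding coldeg_def by (intro member_le_sum) auto
qed (simp add: in_keys_iff)

subsection \<open>Monomials of a given degree\<close>

text \<open>Degrees are integer vectors, so that shifting them needs no side conditions.\<close>
definition mons :: "nat \<Rightarrow> (nat \<times> nat) set \<Rightarrow> (nat \<Rightarrow> int) \<Rightarrow> monom set" where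
  "mons n F u = {m. supp m \<subseteq> F \<and> (\<forall>j<n. int (coldeg m j) = u j)}"

lemma finite_bounded_monoms:
  assumes "finite F"
  shows "finite {m. supp m \<subseteq> F \<and> (\<forall>v\<in>F. mlookup m v \<le> N v)}"
proof -
  let ?A = "{m. supp m \<subseteq> F \<and> (\<forall>v\<in>F. mlookup m v \<le> N v)}"
  let ?M = "\<Sum>v\<in>F. N v"
  have "finite {f. \<forall>v. (v \<in> F \<longrightarrow> f v \<in> {..?M}) \<and> (v \<notin> F \<longrightarrow> f v = 0)}"
    using assms by (intro finite_set_of_finite_funs) auto
  moreover have "mlookup ` ?A \<subseteq> {f. \<forall>v. (v \<in> F \<longrightarrow> f v \<in> {..?M}) \<and> (v \<notin> F \<longrightarrow> f v = 0)}"
    using assms by (auto simp: in_keys_iff subset_iff intro: order_trans member_le_sum)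
  ultimately have "finite (mlookup ` ?A)" by (rule rev_finite_subset)
  then show ?thesis
    by (rule finite_imageD) (auto intro: inj_onI poly_mapping_eqI)
qed

lemma finite_mons:
  assumes "finite F" "snd ` F \<subseteq> {..<n}"
  shows "finite (mons n F u)"
proof (rule finite_subset[OF _ finite_bounded_monoms[OF assms(1)]])
  show "mons n F u \<subseteq> {m. supp m \<subseteq> F \<and> (\<forall>v\<in>F. mlookup m v \<le> nat (u (snd v)))}"
  proof (clarsimp simp: mons_def)
    fix m a b assume m: "\<forall>j<n. int (coldeg m j) = u j" and "(a, b) \<in> F"
    then have "b < n" using assms by force
    then show "mlookup m (a, b) \<le> nat (u b)"
      using m lookup_le_coldeg[of m "(a,b)"] by (metis nat_int snd_conv)
  qed
qed

lemma mons_mult_xvar: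
  assumes "v \<in> F" "snd v = c" "m \<in> mons n F u"
  shows "m + xvar v \<in> mons n F (u(c := u c + 1))"
  using assms by (auto simp: mons_def supp_add coldeg_add coldeg_xvar split: if_splits)

lemma xvar_dvd: "v \<in> supp m \<Longrightarrow> m - xvar v + xvar v = m"
  by (intro poly_mapping_eqI) (auto simp: lookup_add lookup_minus in_keys_iff lookup_single when_def)

lemma mons_div_xvar:
  assumes "v \<in> supp m" "m \<in> mons n F (u(c := u c + 1))" "snd v = c"
  shows "m - xvar v \<in> mons n F u"
proof -
  let ?k = "m - xvar v"
  have e: "m = ?k + xvar v" using xvar_dvd[OF assms(1)] by simp
  have "supp ?k \<subseteq> supp m" by (auto simp: in_keys_iff lookup_minus)
  moreover have "coldeg m j = coldeg ?k j + (if snd v = j then 1 else 0)" for j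
    by (subst e) (simp add: coldeg_add coldeg_xvar)
  ultimately show ?thesis using assms by (fastforce simp: mons_def split: if_splits)
qed

text \<open>The monomials of the larger degree split into the multiples of \<open>v\<close> and
  those free of \<open>v\<close>. Thus a forward difference in column \<open>c\<close> deletes one
  variable of that column.\<close>

lemma card_mons_step:
  assumes "finite F" "snd ` F \<subseteq> {..<n}" "v \<in> F" "snd v = c"
  shows "card (mons n F (u(c := u c + 1)))
       = card (mons n F u) + card (mons n (F - {v}) (u(c := u c + 1)))"
proof -
  let ?u = "u(c := u c + 1)" and ?f = "\<lambda>m. m + xvar v"
  have "mons n F ?u = ?f ` mons n F u \<union> mons n (F - {v}) ?u"
  proof (intro equalityI subsetI)
    fix m assume m: "m \<in> mons n F ?u"
    show "m \<in> ?f ` mons n F u \<union> mons n (F - {v}) ?u"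
    proof (cases "v \<in> supp m")
      case True
      then show ?thesis
        using mons_div_xvar[OF True m assms(4)] xvar_dvd[OF True] by (metis UnI1 image_eqI)
    next
      case False
      with m show ?thesis by (auto simp: mons_def)
    qed
  next
    fix m assume "m \<in> ?f ` mons n F u \<union> mons n (F - {v}) ?u"
    then show "m \<in> mons n F ?u"
      using mons_mult_xvar[OF assms(3,4)] by (auto simp: mons_def)
  qed
  moreover have "?f ` mons n F u \<inter> mons n (F - {v}) ?u = {}"
    by (auto simp: mons_def supp_add)
  moreover have "card (?f ` mons n F u) = card (mons n F u)"
    by (intro card_image inj_onI) simp
  moreover have "finite (mons n F u)" "finite (mons n (F - {v}) ?u)"
    using assms by (auto intro!: finite_mons)
  ultimately show ?thesis by (simp add: card_Un_disjoint)
qed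

subsection \<open>Iterated forward differences\<close>

fun fdiff :: "nat list \<Rightarrow> ((nat \<Rightarrow> int) \<Rightarrow> int) \<Rightarrow> (nat \<Rightarrow> int) \<Rightarrow> int" where
  "fdiff [] h = h"
| "fdiff (c # cs) h = fdiff cs (\<lambda>u. h (u(c := u c + 1)) - h u)"

lemma fdiff_shift: "fdiff cs (\<lambda>u. h (\<lambda>j. u j + s j)) u = fdiff cs h (\<lambda>j. u j + s j)"
proof (induction cs arbitrary: h)
  case (Cons c cs)
  have "(\<lambda>j. (u(c := u c + 1)) j + s j) = (\<lambda>j. u j + s j)(c := u c + s c + 1)" for u
    by (auto simp: fun_eq_iff)
  then show ?case
    using Cons[of "\<lambda>w. h (w(c := w c + 1)) - h w"] by simp
qed simp

lemma fdiff_sum: "fdiff cs (\<lambda>u. \<Sum>a\<in>A. h a u) u = (\<Sum>a\<in>A. fdiff cs (h a) u)"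
proof (induction cs arbitrary: h)
  case (Cons c cs)
  show ?case using Cons[of "\<lambda>a u. h a (u(c := u c + 1)) - h a u"] by (simp add: sum_subtractf)
qed simp

text \<open>Forward differences look only at larger arguments, so agreement on an upper orthant is
  enough. Formulas valid only from some degree on can therefore be differenced.\<close>

lemma fdiff_cong:
  assumes "\<And>u. (\<forall>j<n. l j \<le> u j) \<Longrightarrow> h u = g u" "\<forall>j<n. l j \<le> u j"
  shows "fdiff cs h u = fdiff cs g u"
  using assms(1)
proof (induction cs arbitrary: h g)
  case Nil
  then show ?case using assms(2) by simp
next
  case (Cons c cs)
  have "h (w(c := w c + 1)) - h w = g (w(c := w c + 1)) - g w" if "\<forall>j<n. l j \<le> w j" for w
  proof -
    have "\<forall>j<n. l j \<le> (w(c := w c + 1)) j" using that by (auto intro: add_increasing2)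
    then show ?thesis using Cons.prems that by metis
  qed
  then show ?case
    using Cons.IH[of "\<lambda>u. h (u(c := u c + 1)) - h u" "\<lambda>u. g (u(c := u c + 1)) - g u"] by simp
qed

lemma fdiff_zero: "fdiff cs (\<lambda>u. 0) = (\<lambda>u. 0)"
  by (induction cs) auto

text \<open>By Pascal's rule a difference in any column lowers the lower binomial index by one. The
  summand \<open>k\<close> stays fixed, so it is kept independent of \<open>cs\<close> for the
  induction.\<close>

lemma fdiff_choose:
  assumes "\<And>u. (\<forall>j<n. 0 \<le> u j) \<Longrightarrow> h u = int ((nat (\<Sum>j<n. u j) + k) choose length cs)"
    and "\<forall>j<n. 0 \<le> u j" "set cs \<subseteq> {..<n}"
  shows "fdiff cs h u = 1"
  using assms(1,3)
proof (induction cs arbitrary: h)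
  case Nil
  then show ?case using assms(2) by simp
next
  case (Cons c cs)
  have "h (u(c := u c + 1)) - h u = int ((nat (\<Sum>j<n. u j) + k) choose length cs)"
    if u: "\<forall>j<n. 0 \<le> u j" for u
  proof -
    have "(\<Sum>j<n. (u(c := u c + 1)) j) = (\<Sum>j<n. u j + (if j = c then 1 else 0))"
      by (intro sum.cong) auto
    also have "\<dots> = (\<Sum>j<n. u j) + 1" using Cons.prems(2) by (simp add: sum.distrib)
    moreover have "0 \<le> (\<Sum>j<n. u j)" using u by (intro sum_nonneg) auto
    ultimately have s: "nat (\<Sum>j<n. (u(c := u c + 1)) j) + k = Suc (nat (\<Sum>j<n. u j) + k)"
      by (simp add: nat_add_distrib)
    have "\<forall>j<n. 0 \<le> (u(c := u c + 1)) j" using u by auto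
    from Cons.prems(1)[OF this]
    have "h (u(c := u c + 1)) = int (Suc (nat (\<Sum>j<n. u j) + k) choose length (c # cs))"
      unfolding s .
    with Cons.prems(1)[OF u] show ?thesis by simp
  qed
  then show ?case using Cons.IH[of "\<lambda>u. h (u(c := u c + 1)) - h u"] Cons.prems(2) by simp
qed

text \<open>Each difference in a column removes one of its variables, so \<open>cs\<close> exhausts
  some column. An empty column admits no monomial of positive degree; the bound
  \<open>1 \<le> u j\<close> excludes the constant monomial.\<close>

lemma fdiff_mons_eq_0:
  assumes "finite F" "snd ` F \<subseteq> {..<n}" "\<forall>j<n. 1 \<le> u j"
    and "\<exists>j<n. card {v\<in>F. snd v = j} \<le> count_list cs j" "set cs \<subseteq> {..<n}"
  shows "fdiff cs (\<lambda>u. int (card (mons n F u))) u = 0"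
  using assms
proof (induction cs arbitrary: F u)
  have empty_col: "mons n F u = {}"
    if F: "finite F" and u: "\<forall>j<n. 1 \<le> u j" and c: "c < n" "{v\<in>F. snd v = c} = {}" for F u c
  proof -
    have "coldeg m c = 0" if "supp m \<subseteq> F" for m
      using coldeg_superset[OF F that, of c] unfolding c(2) by simp
    then show ?thesis using u c(1) by (fastforce simp: mons_def)
  qed
  {
    case Nil
    then obtain j where j: "j < n" "card {v\<in>F. snd v = j} = 0" by auto
    then have "{v\<in>F. snd v = j} = {}" using Nil(1) by simp
    then show ?case using empty_col[OF Nil(1) Nil(3) j(1)] by simp
  next
    case (Cons c cs)
    show ?case
    proof (cases "{v\<in>F. snd v = c} = {}")
      case True
      \<comment> \<open>Column \<open>c\<close> is already empty, so the counting function vanishes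
        on all degrees that the differences visit.\<close>
      have "fdiff (c # cs) (\<lambda>u. int (card (mons n F u))) u = fdiff (c # cs) (\<lambda>u. 0) u"
        using empty_col[OF Cons(2) _ _ True] Cons
        by (intro fdiff_cong[of n "\<lambda>_. 1"]) auto
      then show ?thesis unfolding fdiff_zero by simp
    next
      case False
      then obtain v where v: "v \<in> F" "snd v = c" by auto
      let ?e = "\<lambda>j. if j = c then 1 else 0 :: int"
      let ?g = "\<lambda>u. int (card (mons n (F - {v}) u))"
      have e: "u(c := u c + 1) = (\<lambda>j. u j + ?e j)" for u :: "nat \<Rightarrow> int" by auto
      have "fdiff (c # cs) (\<lambda>u. int (card (mons n F u))) u = fdiff cs (\<lambda>u. ?g (u(c := u c + 1))) u"
        by (simp only: fdiff.simps card_mons_step[OF Cons(2,3) v]) simp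
      also have "\<dots> = fdiff cs ?g (\<lambda>j. u j + ?e j)"
        unfolding e by (rule fdiff_shift)
      also have "\<dots> = 0"
      proof (rule Cons.IH)
        obtain j where j: "j < n" "card {v\<in>F. snd v = j} \<le> count_list (c # cs) j"
          using Cons.prems by blast
        have "{w \<in> F - {v}. snd w = j} = {w\<in>F. snd w = j} - {v}" by auto
        then have "card {w \<in> F - {v}. snd w = j} \<le> count_list cs j"
          using j Cons.prems(1) v by (auto split: if_splits)
        with j(1) show "\<exists>j<n. card {w \<in> F - {v}. snd w = j} \<le> count_list cs j" by blast
        show "\<forall>j<n. 1 \<le> u j + ?e j" using Cons.prems(3) by auto
      qed (use Cons.prems in auto)
      finally show ?thesis .
    qed
  }
qed

subsection \<open>Faces of an order ideal of monomials\<close>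

text \<open>Refine one coordinate at a time. A monotone subsequence of naturals either increases
  already or decreases and is then eventually constant, so a tail of it is nondecreasing.\<close>

lemma ex_mono_subsequence:
  fixes f :: "nat \<Rightarrow> 'b \<Rightarrow> nat"
  assumes "finite V"
  shows "\<exists>r :: nat \<Rightarrow> nat. strict_mono r \<and> (\<forall>v\<in>V. mono (\<lambda>k. f (r k) v))"
  using assms
proof induction
  case empty
  then show ?case by (auto intro: exI[of _ id] simp: strict_mono_def)
next
  case (insert v V)
  then obtain r :: "nat \<Rightarrow> nat" where r: "strict_mono r" "\<forall>v\<in>V. mono (\<lambda>k. f (r k) v)" by auto
  obtain g where g: "strict_mono g" "monoseq (\<lambda>k. f (r (g k)) v)"
    using seq_monosub[of "\<lambda>k. f (r k) v"] by auto
  have "\<exists>K. mono (\<lambda>k. f (r (g (k + K))) v)"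
  proof (cases "incseq (\<lambda>k. f (r (g k)) v)")
    case True
    then show ?thesis by (intro exI[of _ 0]) simp
  next
    case False
    then have dec: "decseq (\<lambda>k. f (r (g k)) v)" using g(2) by (simp add: monoseq_iff)
    define X where "X = (\<lambda>k. f (r (g k)) v)"
    \<comment> \<open>\<open>X\<close> attains its minimum at \<open>K\<close>; being decreasing, it
      is constant from there on.\<close>
    obtain K where K: "X K = (LEAST x. x \<in> range X)"
      using LeastI[of "\<lambda>x. x \<in> range X" "X 0"] by auto
    have "X (k + K) = X K" for k
    proof (rule antisym)
      show "X (k + K) \<le> X K" using dec unfolding X_def decseq_def by simp
      show "X K \<le> X (k + K)" unfolding K by (rule Least_le) simp
    qed
    then have "mono (\<lambda>k. X (k + K))" by (simp add: mono_def)
    then show ?thesis unfolding X_def by blast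
  qed
  then obtain K where K: "mono (\<lambda>k. f (r (g (k + K))) v)" by blast
  have shift: "strict_mono (\<lambda>k. g (k + K))" using g(1) by (simp add: strict_mono_def)
  have "mono (\<lambda>k. f (r (g (k + K))) w)" if "w \<in> V" for w
  proof -
    have "mono (\<lambda>k. f (r k) w)" using r(2) that by blast
    moreover have "mono (\<lambda>k. g (k + K))" using shift by (rule strict_mono_mono)
    ultimately show ?thesis by (simp add: mono_def)
  qed
  moreover have "strict_mono (\<lambda>k. r (g (k + K)))"
    using r(1) shift by (simp add: strict_mono_def)
  ultimately show ?case using K by (intro exI[of _ "\<lambda>k. r (g (k + K))"]) auto
qed

definition cut :: "nat \<Rightarrow> monom \<Rightarrow> monom" where
  "cut N m = Poly_Mapping.map (min N) m"

lemma lookup_cut: "mlookup (cut N m) v = min N (mlookup m v)"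
  unfolding cut_def by (simp add: Poly_Mapping.map.rep_eq when_def)

definition order_ideal :: "monom set \<Rightarrow> bool" where
  "order_ideal B \<longleftrightarrow> (\<forall>m k. m + k \<in> B \<longrightarrow> m \<in> B)"

lemma order_idealD:
  assumes "order_ideal B" "b \<in> B" "\<And>v. mlookup a v \<le> mlookup b v"
  shows "a \<in> B"
proof -
  have "a + (b - a) \<in> B" using assms(2) monom_diff_add[OF assms(3)] by simp
  then show ?thesis using assms(1) unfolding order_ideal_def by blast
qed

text \<open>Dickson's lemma, phrased with truncated exponents.\<close>
lemma order_ideal_cutoff:
  assumes "finite V" "order_ideal B"
  shows "\<exists>N. \<forall>m. supp m \<subseteq> V \<longrightarrow> cut N m \<in> B \<longrightarrow> m \<in> B"
proof (rule ccontr)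
  assume "\<not> ?thesis"
  then obtain m where m: "\<And>N. supp (m N) \<subseteq> V" "\<And>N. cut N (m N) \<in> B" "\<And>N. m N \<notin> B"
    by metis
  obtain r :: "nat \<Rightarrow> nat" where r: "strict_mono r" "\<forall>v\<in>V. mono (\<lambda>k. mlookup (m (r k)) v)"
    using ex_mono_subsequence[OF assms(1), of "\<lambda>k. mlookup (m k)"] by blast
  \<comment> \<open>\<open>M\<close> bounds all exponents of \<open>m (r 0)\<close>, so truncating
    \<open>m (r M)\<close> at \<open>r M \<ge> M\<close> leaves it divisible by
    \<open>m (r 0)\<close>, which would force \<open>m (r 0)\<close> into \<open>B\<close>.\<close>
  define M where "M = (\<Sum>v\<in>V. mlookup (m (r 0)) v)"
  have "mlookup (m (r 0)) v \<le> mlookup (cut (r M) (m (r M))) v" for v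
  proof (cases "v \<in> V")
    case True
    then have "mlookup (m (r 0)) v \<le> M"
      unfolding M_def using assms(1) by (intro member_le_sum) auto
    also have "M \<le> r M" using r(1) by (rule strict_mono_imp_increasing)
    finally show ?thesis using r(2) True by (auto simp: lookup_cut dest: monoD[of _ 0 M])
  next
    case False
    then have "v \<notin> supp (m (r 0))" using m(1) by blast
    then show ?thesis by (simp add: in_keys_iff)
  qed
  from order_idealD[OF assms(2) m(2) this] m(3) show False by blast
qed

text \<open>The monomials whose truncation \<open>cut N\<close> is a given \<open>a\<close> are the multiples of \<open>a\<close> by
  monomials in the variables of exponent \<open>N\<close> in \<open>a\<close>. This splits an order ideal into finitely
  many translates of coordinate orthants, each of which has an explicit Hilbert function.\<close>
lemma card_cut_fibre:
  assumes "\<forall>v. mlookup a v \<le> N" "supp a \<subseteq> V"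
  shows "card {m \<in> mons n V u. cut N m = a}
       = card (mons n {v\<in>V. mlookup a v = N} (\<lambda>j. u j + - int (coldeg a j)))"
proof -
  let ?F = "{v\<in>V. mlookup a v = N}"
  let ?S = "mons n ?F (\<lambda>j. u j + - int (coldeg a j))"
  have "{m \<in> mons n V u. cut N m = a} = (\<lambda>k. a + k) ` ?S"
  proof (intro equalityI subsetI)
    fix m assume m: "m \<in> {m \<in> mons n V u. cut N m = a}"
    then have l: "mlookup a v = min N (mlookup m v)" for v by (auto simp: lookup_cut[symmetric])
    have e: "a + (m - a) = m" using l by (intro monom_diff_add) auto
    have "coldeg m j = coldeg a j + coldeg (m - a) j" for j
      using coldeg_add[of a "m - a" j] unfolding e .
    moreover have "supp (m - a) \<subseteq> ?F"
      using m l by (auto simp: mons_def in_keys_iff lookup_minus subset_iff)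
    ultimately have "m - a \<in> ?S" using m by (auto simp: mons_def)
    then show "m \<in> (\<lambda>k. a + k) ` ?S" by (intro image_eqI[where x = "m - a"]) (simp_all add: e)
  next
    fix m assume "m \<in> (\<lambda>k. a + k) ` ?S"
    then obtain k where k: "m = a + k" "k \<in> ?S" by (rule imageE)
    have "cut N m = a"
    proof (rule poly_mapping_eqI)
      fix v
      show "mlookup (cut N m) v = mlookup a v"
      proof (cases "v \<in> supp k")
        case True
        then show ?thesis using k by (auto simp: lookup_cut lookup_add mons_def)
      next
        case False
        then show ?thesis
          using spec[OF assms(1), of v] k(1) by (simp add: lookup_cut lookup_add in_keys_iff)
      qed
    qed
    moreover have "m \<in> mons n V u" using k assms(2) by (auto simp: mons_def supp_add coldeg_add)
    ultimately show "m \<in> {m \<in> mons n V u. cut N m = a}" by simp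
  qed
  then show ?thesis by (simp add: card_image)
qed

text \<open>The difference along \<open>cs\<close> of the Hilbert function of \<open>B\<close> is 1,
  whereas an orthant with too few variables in some column contributes 0 by
  \<open>fdiff_mons_eq_0\<close>. So some orthant of the splitting by \<open>cut N\<close> is large
  in every column.\<close>

lemma ex_face:
  assumes V: "finite V" "snd ` V \<subseteq> {..<n}"
    and B: "order_ideal B" "\<And>m. m \<in> B \<Longrightarrow> supp m \<subseteq> V"
    and card: "\<And>u. (\<forall>j<n. 0 \<le> u j) \<Longrightarrow>
      card (B \<inter> mons n V u) = (nat (\<Sum>j<n. u j) + length cs) choose length cs"
    and cs: "set cs \<subseteq> {..<n}"
  shows "\<exists>F\<subseteq>V. (\<forall>j<n. count_list cs j < card {v\<in>F. snd v = j}) \<and> (\<forall>m. supp m \<subseteq> F \<longrightarrow> m \<in> B)"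
proof (rule ccontr)
  assume no_face: "\<not> ?thesis"
  obtain N where N: "\<And>m. supp m \<subseteq> V \<Longrightarrow> cut N m \<in> B \<Longrightarrow> m \<in> B"
    using order_ideal_cutoff[OF V(1) B(1)] by blast
  define A where "A = {a\<in>B. \<forall>v. mlookup a v \<le> N}"
  define F where "F a = {v\<in>V. mlookup a v = N}" for a
  have "finite A"
    by (rule finite_subset[OF _ finite_bounded_monoms[OF V(1), of "\<lambda>_. N"]])
      (use B(2) in \<open>auto simp: A_def\<close>)
  have small: "\<exists>j<n. card {v\<in>F a. snd v = j} \<le> count_list cs j" if a: "a \<in> A" for a
  proof -
    \<comment> \<open>Truncating a monomial in the variables of \<open>F a\<close> gives a divisor
      of \<open>a\<close>, so the cutoff property of \<open>N\<close> puts the whole orthant into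
      \<open>B\<close>.\<close>
    have "m \<in> B" if "supp m \<subseteq> F a" for m
    proof (rule N)
      show "supp m \<subseteq> V" using that by (auto simp: F_def)
      have "mlookup (cut N m) v \<le> mlookup a v" for v
      proof (cases "v \<in> supp m")
        case True
        then show ?thesis using that by (auto simp: F_def lookup_cut)
      qed (simp add: lookup_cut in_keys_iff)
      then show "cut N m \<in> B" using order_idealD[OF B(1)] a by (auto simp: A_def)
    qed
    moreover have "F a \<subseteq> V" by (auto simp: F_def)
    ultimately show ?thesis using no_face by (meson not_le)
  qed
  have split: "int (card (B \<inter> mons n V u))
      = (\<Sum>a\<in>A. int (card (mons n (F a) (\<lambda>j. u j + - int (coldeg a j)))))" for u
  proof -
    have "B \<inter> mons n V u = (\<Union>a\<in>A. {m \<in> mons n V u. cut N m = a})"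
    proof (intro equalityI subsetI)
      fix m assume m: "m \<in> B \<inter> mons n V u"
      then have "cut N m \<in> A"
        using order_idealD[OF B(1), of m "cut N m"] by (auto simp: A_def lookup_cut)
      with m show "m \<in> (\<Union>a\<in>A. {m \<in> mons n V u. cut N m = a})" by blast
    qed (use N in \<open>auto simp: A_def mons_def\<close>)
    also have "card \<dots> = (\<Sum>a\<in>A. card {m \<in> mons n V u. cut N m = a})"
      using \<open>finite A\<close> finite_mons[OF V] by (intro card_UN_disjoint) auto
    also have "\<dots> = (\<Sum>a\<in>A. card (mons n (F a) (\<lambda>j. u j + - int (coldeg a j))))"
      unfolding F_def using B(2) by (intro sum.cong refl card_cut_fibre) (auto simp: A_def)
    finally show ?thesis by simp
  qed
  \<comment> \<open>A degree so large that all translated degrees \<open>U j - coldeg a j\<close>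
    are at least 1, as \<open>fdiff_mons_eq_0\<close> demands.\<close>
  define U where "U j = 1 + int (\<Sum>a\<in>A. coldeg a j)" for j
  have U: "1 \<le> U j + - int (coldeg a j)" if "a \<in> A" for a j
  proof -
    have "coldeg a j \<le> (\<Sum>a\<in>A. coldeg a j)"
      using that \<open>finite A\<close> by (intro member_le_sum) auto
    then show ?thesis unfolding U_def by linarith
  qed
  have "1 = fdiff cs (\<lambda>u. int (card (B \<inter> mons n V u))) U"
    by (rule fdiff_choose[OF _ _ cs, symmetric]) (auto simp: card U_def intro!: add_nonneg_nonneg sum_nonneg)
  also have "\<dots> = (\<Sum>a\<in>A. fdiff cs (\<lambda>u. int (card (mons n (F a) (\<lambda>j. u j + - int (coldeg a j))))) U)"
    unfolding split by (rule fdiff_sum)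
  also have "\<dots> = (\<Sum>a\<in>A. fdiff cs (\<lambda>u. int (card (mons n (F a) u))) (\<lambda>j. U j + - int (coldeg a j)))"
    by (intro sum.cong refl fdiff_shift)
  also have "\<dots> = 0"
    using V cs small U by (intro sum.neutral ballI fdiff_mons_eq_0) (auto simp: F_def)
  finally show False by simp
qed

subsection \<open>Unions of coordinate orthants\<close>

definition covered :: "(nat \<times> nat) set set \<Rightarrow> monom set" where
  "covered \<F> = {m. \<exists>F\<in>\<F>. supp m \<subseteq> F}"

text \<open>The combinatorial shadow of cutting by a generic linear form in column \<open>c\<close>: a covered
  monomial is multiplied by the largest variable of column \<open>c\<close> that keeps it covered. This map
  is injective and misses the monomials covered by \<open>\<G>\<close>.\<close>
lemma card_covered_step:
  assumes V: "finite V" "snd ` V \<subseteq> {..<n}" and \<F>V: "\<And>F. F \<in> \<F> \<Longrightarrow> F \<subseteq> V"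
    and col: "\<And>F. F \<in> \<F> \<Longrightarrow> \<exists>v\<in>F. snd v = c"
    and \<G>: "\<And>G. G \<in> \<G> \<Longrightarrow>
      \<exists>F\<in>\<F>. G \<subseteq> F \<and> (\<exists>v\<in>F. snd v = c \<and> (\<forall>w\<in>G. snd w = c \<longrightarrow> fst w < fst v))"
  shows "card (covered \<F> \<inter> mons n V u) + card (covered \<G> \<inter> mons n V (u(c := u c + 1)))
     \<le> card (covered \<F> \<inter> mons n V (u(c := u c + 1)))"
proof -
  let ?u = "u(c := u c + 1)"
  define P where "P m = {i. m + xvar (i, c) \<in> covered \<F>}" for m
  define f where "f m = m + xvar (Max (P m), c)" for m
  have P_fst: "P m \<subseteq> fst ` V" for m
    using \<F>V by (force simp: P_def covered_def supp_add)
  have finP: "finite (P m)" for m using finite_subset[OF P_fst] V(1) by blast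
  have P_ne: "P m \<noteq> {}" if "m \<in> covered \<F>" for m
    using that col by (fastforce simp: P_def covered_def supp_add)
  have f_cov: "f m \<in> covered \<F>" if "m \<in> covered \<F>" for m
    using Max_in[OF finP P_ne[OF that]] by (simp add: f_def P_def)
  have "f ` (covered \<F> \<inter> mons n V u) \<subseteq> covered \<F> \<inter> mons n V ?u"
  proof clarify
    fix m assume m: "m \<in> covered \<F>" "m \<in> mons n V u"
    have "(Max (P m), c) \<in> V"
      using f_cov[OF m(1)] \<F>V by (fastforce simp: f_def covered_def supp_add)
    then show "f m \<in> covered \<F> \<inter> mons n V ?u"
      using f_cov[OF m(1)] mons_mult_xvar[of "(Max (P m), c)" V c m n u] m(2) by (simp add: f_def)
  qed
  moreover have "covered \<G> \<inter> mons n V ?u \<subseteq> covered \<F> \<inter> mons n V ?u"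
  proof
    fix m assume m: "m \<in> covered \<G> \<inter> mons n V ?u"
    then obtain G where "G \<in> \<G>" "supp m \<subseteq> G" by (auto simp: covered_def)
    then have "m \<in> covered \<F>" using \<G>[of G] unfolding covered_def by blast
    with m show "m \<in> covered \<F> \<inter> mons n V ?u" by blast
  qed
  moreover have "f ` (covered \<F> \<inter> mons n V u) \<inter> (covered \<G> \<inter> mons n V ?u) = {}"
  proof (rule ccontr)
    assume "\<not> ?thesis"
    then obtain m G where m: "m \<in> covered \<F>" "G \<in> \<G>" "supp (f m) \<subseteq> G"
      by (auto simp: covered_def)
    \<comment> \<open>\<open>v\<close> exceeds everything in column \<open>c\<close> of
      \<open>G\<close>, yet multiplying \<open>m\<close> by it stays inside \<open>F\<close>. It
      would have been a larger choice than the variable used by \<open>f\<close>, which lies in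
      \<open>G\<close>.\<close>
    obtain F v where F: "F \<in> \<F>" "G \<subseteq> F" "v \<in> F" "snd v = c"
      "\<forall>w\<in>G. snd w = c \<longrightarrow> fst w < fst v" using \<G>[OF m(2)] by blast
    have "(Max (P m), c) \<in> G" "supp m \<subseteq> G" using m(3) by (auto simp: f_def supp_add)
    moreover have "fst v \<in> P m"
      using F \<open>supp m \<subseteq> G\<close> by (cases v) (auto simp: P_def covered_def supp_add)
    ultimately show False using F(5) Max_ge[OF finP, of "fst v" m] by fastforce
  qed
  moreover have "inj_on f (covered \<F> \<inter> mons n V u)"
  proof -
    \<comment> \<open>If the two added variables differ, the one added to \<open>m'\<close> already
      divides \<open>m\<close>. Multiplying \<open>m\<close> by it keeps the support, so its row
      belongs to \<open>P m\<close>.\<close>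
    have le: "Max (P m') \<le> Max (P m)" if m: "m \<in> covered \<F>" "f m = f m'" for m m'
    proof (cases "Max (P m') = Max (P m)")
      case False
      have "(Max (P m'), c) \<in> supp (f m)" unfolding m(2) by (simp add: f_def supp_add)
      then have "(Max (P m'), c) \<in> supp m" using False by (simp add: f_def supp_add)
      then have "supp (m + xvar (Max (P m'), c)) = supp m" by (auto simp: supp_add)
      then have "Max (P m') \<in> P m" using m(1) by (simp add: P_def covered_def)
      then show ?thesis by (rule Max_ge[OF finP])
    qed simp
    show ?thesis
    proof (rule inj_onI)
      fix m m' assume "m \<in> covered \<F> \<inter> mons n V u" "m' \<in> covered \<F> \<inter> mons n V u" "f m = f m'"
      moreover from this have "Max (P m) = Max (P m')" using le by (metis IntD1 antisym)
      ultimately show "m = m'" by (simp add: f_def)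
    qed
  qed
  moreover have "finite (covered \<F> \<inter> mons n V u)" "finite (covered \<G> \<inter> mons n V ?u)"
    "finite (covered \<F> \<inter> mons n V ?u)" using finite_mons[OF V] by auto
  ultimately show ?thesis
    using card_Un_disjoint[of "f ` (covered \<F> \<inter> mons n V u)" "covered \<G> \<inter> mons n V ?u"]
      card_mono[of "covered \<F> \<inter> mons n V ?u"
        "f ` (covered \<F> \<inter> mons n V u) \<union> (covered \<G> \<inter> mons n V ?u)"]
    by (simp only: card_image finite_imageI Un_least)
qed

text \<open>A word stands for the vector of its letter counts. Rearrangements of a word may be
  assigned different faces, which is harmless because only the counts enter the bounds.\<close>

definition words :: "nat \<Rightarrow> nat \<Rightarrow> nat list set" where
  "words n D = {cs. length cs = D \<and> set cs \<subseteq> {..<n}}"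

text \<open>Pascal's rule matches \<open>card_covered_step\<close>: one summand comes from the same
  family in degree \<open>u\<close>, the other from a family indexed by words of length one less in
  the raised degree.\<close>

lemma card_covered_ge:
  assumes V: "finite V" "snd ` V \<subseteq> {..<n}" and n: "0 < n"
    and F: "\<And>cs. cs \<in> words n D \<Longrightarrow> F cs \<subseteq> V"
      "\<And>cs j. cs \<in> words n D \<Longrightarrow> j < n \<Longrightarrow> count_list cs j < card {v\<in>F cs. snd v = j}"
    and u: "\<forall>j<n. 0 \<le> u j"
  shows "(nat (\<Sum>j<n. u j) + D) choose D \<le> card (covered (F ` words n D) \<inter> mons n V u)"
  using F u
proof (induction D arbitrary: F u)
  have words_ne: "words n D \<noteq> {}" for D
    using n by (auto simp: words_def intro!: exI[of _ "replicate D 0"])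
  \<comment> \<open>Nonnegative degrees are reached from zero by raising one column at a time.
    Entries at indices from \<open>n\<close> on are arbitrary, so the base case covers every
    \<open>u\<close> vanishing below \<open>n\<close>.\<close>
  have degree_induct: "P u"
    if "\<forall>j<n. 0 \<le> u j"
      and base: "\<And>u. \<forall>j<n. u j = 0 \<Longrightarrow> P u"
      and step: "\<And>u c. \<forall>j<n. 0 \<le> u j \<Longrightarrow> c < n \<Longrightarrow> P u \<Longrightarrow> P (u(c := u c + 1))"
    for P and u :: "nat \<Rightarrow> int"
    using that(1)
  proof (induction "nat (\<Sum>j<n. u j)" arbitrary: u rule: less_induct)
    case less
    show ?case
    proof (cases "\<forall>j<n. u j = 0")
      case False
      then obtain c where c: "c < n" "0 < u c" using less.prems by force
      let ?w = "u(c := u c - 1)"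
      have "(\<Sum>j<n. ?w j) < (\<Sum>j<n. u j)" using c by (intro sum_strict_mono_ex1) auto
      moreover have w: "\<forall>j<n. 0 \<le> ?w j" using c less.prems by auto
      moreover have "0 \<le> (\<Sum>j<n. ?w j)" using w by (intro sum_nonneg) auto
      ultimately have "P ?w" by (intro less.hyps) auto
      from step[OF w c(1) this] show ?thesis by simp
    qed (rule base)
  qed
  have base: "1 \<le> card (covered (F ` words n D) \<inter> mons n V u)" if "\<forall>j<n. u j = 0" for F D u
  proof -
    have "0 \<in> covered (F ` words n D) \<inter> mons n V u"
      using that words_ne by (auto simp: covered_def mons_def coldeg_def)
    then show ?thesis using finite_mons[OF V, of u]
      by (metis One_nat_def Suc_leI card_gt_0_iff empty_iff finite_Int)
  qed
  have col: "\<exists>v\<in>H. snd v = c"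
    if F: "\<And>cs j. cs \<in> words n D \<Longrightarrow> j < n \<Longrightarrow> count_list cs j < card {v\<in>F cs. snd v = j}"
      and H: "H \<in> F ` words n D" "c < n" for F D H c
  proof -
    obtain cs where "cs \<in> words n D" "H = F cs" using H by blast
    then have "card {v\<in>H. snd v = c} \<noteq> 0" using F[of cs c] H by simp
    then show ?thesis by (metis (mono_tags, lifting) card.empty empty_Collect_eq)
  qed
  {
    case 0
    \<comment> \<open>The bound is 1 here: with an empty second family,
      \<open>card_covered_step\<close> says that the count never drops when the degree is
      raised.\<close>
    from "0.prems"(3) have "1 \<le> card (covered (F ` words n 0) \<inter> mons n V u)"
    proof (rule degree_induct)
      fix u :: "nat \<Rightarrow> int" and c
      assume "c < n" "1 \<le> card (covered (F ` words n 0) \<inter> mons n V u)"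
      then show "1 \<le> card (covered (F ` words n 0) \<inter> mons n V (u(c := u c + 1)))"
        using card_covered_step[OF V, of "F ` words n 0" c "{}" u] "0.prems"(1) col[OF "0.prems"(2)]
        by fastforce
    qed (rule base)
    then show ?case by simp
  next
    case (Suc D)
    from Suc.prems(3) show ?case
    proof (rule degree_induct)
      fix u :: "nat \<Rightarrow> int" assume u: "\<forall>j<n. u j = 0"
      then have "(\<Sum>j<n. u j) = 0" by simp
      then show "(nat (\<Sum>j<n. u j) + Suc D) choose Suc D
          \<le> card (covered (F ` words n (Suc D)) \<inter> mons n V u)"
        using base[OF u] by simp
    next
      fix u :: "nat \<Rightarrow> int" and c
      assume u: "\<forall>j<n. 0 \<le> u j" and c: "c < n"
        and IH: "(nat (\<Sum>j<n. u j) + Suc D) choose Suc D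
          \<le> card (covered (F ` words n (Suc D)) \<inter> mons n V u)"
      let ?u = "u(c := u c + 1)"
      \<comment> \<open>Deleting the top variable of column \<open>c\<close> lowers the count there
        by one, just as passing from \<open>c # cs\<close> to \<open>cs\<close> does. The deleted
        variable is the witness \<open>v\<close> required by
        \<open>card_covered_step\<close>.\<close>
      define top where "top H = (Max {i. (i, c) \<in> H}, c)" for H :: "(nat \<times> nat) set"
      define G where "G cs = F (c # cs) - {top (F (c # cs))}" for cs
      have cons: "c # cs \<in> words n (Suc D)" if "cs \<in> words n D" for cs
        using that c by (auto simp: words_def)
      have top: "top (F (c # cs)) \<in> F (c # cs)"
        "\<And>v. v \<in> F (c # cs) \<Longrightarrow> snd v = c \<Longrightarrow> fst v \<le> fst (top (F (c # cs)))"
        if cs: "cs \<in> words n D" for cs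
      proof -
        let ?T = "{i. (i, c) \<in> F (c # cs)}"
        have "?T \<subseteq> fst ` V" using Suc.prems(1)[OF cons[OF cs]] by force
        then have "finite ?T" using V(1) finite_subset by blast
        moreover have "?T \<noteq> {}"
          using col[OF Suc.prems(2) imageI[OF cons[OF cs]] c] by auto
        ultimately show "top (F (c # cs)) \<in> F (c # cs)"
          "\<And>v. v \<in> F (c # cs) \<Longrightarrow> snd v = c \<Longrightarrow> fst v \<le> fst (top (F (c # cs)))"
          using Max_in[of ?T] Max_ge[of ?T] by (auto simp: top_def)
      qed
      have "(nat (\<Sum>j<n. ?u j) + D) choose D \<le> card (covered (G ` words n D) \<inter> mons n V ?u)"
      proof (rule Suc.IH)
        fix cs assume cs: "cs \<in> words n D"
        then show "G cs \<subseteq> V" using Suc.prems(1)[OF cons[OF cs]] by (auto simp: G_def)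
        fix j assume j: "j < n"
        have "{v\<in>G cs. snd v = j} = {v\<in>F (c # cs). snd v = j} - {top (F (c # cs))}"
          by (auto simp: G_def)
        moreover have "finite (F (c # cs))"
          using Suc.prems(1)[OF cons[OF cs]] V(1) finite_subset by blast
        moreover have "snd (top (F (c # cs))) = c" by (simp add: top_def)
        ultimately show "count_list cs j < card {v\<in>G cs. snd v = j}"
          using Suc.prems(2)[OF cons[OF cs] j] top(1)[OF cs] by (cases "j = c") auto
      qed (use u in auto)
      moreover have "card (covered (F ` words n (Suc D)) \<inter> mons n V u)
          + card (covered (G ` words n D) \<inter> mons n V ?u)
          \<le> card (covered (F ` words n (Suc D)) \<inter> mons n V ?u)"
      proof (rule card_covered_step[OF V])
        fix H assume "H \<in> G ` words n D"
        then obtain cs where cs: "cs \<in> words n D" "H = G cs" by blast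
        have "fst w < fst (top (F (c # cs)))" if "w \<in> H" "snd w = c" for w
        proof -
          have "fst w \<le> fst (top (F (c # cs)))" using top(2)[OF cs(1)] that cs(2) by (auto simp: G_def)
          moreover have "w \<noteq> top (F (c # cs))" using that cs(2) by (auto simp: G_def)
          ultimately show ?thesis using that(2) by (auto simp: top_def prod_eq_iff)
        qed
        then show "\<exists>F\<in>F ` words n (Suc D). H \<subseteq> F \<and>
            (\<exists>v\<in>F. snd v = c \<and> (\<forall>w\<in>H. snd w = c \<longrightarrow> fst w < fst v))"
          using cons[OF cs(1)] top(1)[OF cs(1)] cs(2)
          by (intro bexI[of _ "F (c # cs)"] conjI bexI[of _ "top (F (c # cs))"])
            (auto simp: G_def, simp add: top_def)
      qed (use Suc.prems(1) col[OF Suc.prems(2) _ c] in auto)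
      moreover have "nat (\<Sum>j<n. ?u j) = Suc (nat (\<Sum>j<n. u j))"
      proof -
        have "(\<Sum>j<n. ?u j) = (\<Sum>j<n. u j + (if j = c then 1 else 0))" by (intro sum.cong) auto
        also have "\<dots> = (\<Sum>j<n. u j) + 1" using c by (simp add: sum.distrib)
        finally have "(\<Sum>j<n. ?u j) = (\<Sum>j<n. u j) + 1" .
        moreover have "0 \<le> (\<Sum>j<n. u j)" using u by (intro sum_nonneg) auto
        ultimately show ?thesis by (simp add: nat_add_distrib)
      qed
      ultimately show "(nat (\<Sum>j<n. ?u j) + Suc D) choose Suc D
          \<le> card (covered (F ` words n (Suc D)) \<inter> mons n V ?u)"
        using IH by simp
    qed
  }
qed

text \<open>The faces from \<open>ex_face\<close> lie in \<open>B\<close>, and by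
  \<open>card_covered_ge\<close> they already account for all of \<open>B\<close> in each
  degree.\<close>

theorem order_ideal_support_determined:
  assumes V: "finite V" "snd ` V \<subseteq> {..<n}" and n: "0 < n"
    and B: "order_ideal B" "\<And>m. m \<in> B \<Longrightarrow> supp m \<subseteq> V"
    and card: "\<And>u. (\<forall>j<n. 0 \<le> u j) \<Longrightarrow>
      card (B \<inter> mons n V u) = (nat (\<Sum>j<n. u j) + D) choose D"
    and m: "m \<in> B" "supp m' \<subseteq> supp m"
  shows "m' \<in> B"
proof -
  have "\<exists>F. \<forall>cs\<in>words n D. F cs \<subseteq> V \<and> (\<forall>j<n. count_list cs j < card {v\<in>F cs. snd v = j})
      \<and> (\<forall>m. supp m \<subseteq> F cs \<longrightarrow> m \<in> B)"
  proof (rule bchoice, rule ballI)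
    fix cs assume "cs \<in> words n D"
    then show "\<exists>F\<subseteq>V. (\<forall>j<n. count_list cs j < card {v\<in>F. snd v = j})
        \<and> (\<forall>m. supp m \<subseteq> F \<longrightarrow> m \<in> B)"
      using V B card by (intro ex_face) (auto simp: words_def)
  qed
  then obtain F where "\<forall>cs\<in>words n D. F cs \<subseteq> V
      \<and> (\<forall>j<n. count_list cs j < card {v\<in>F cs. snd v = j})
      \<and> (\<forall>m. supp m \<subseteq> F cs \<longrightarrow> m \<in> B)" ..
  then have F: "\<And>cs. cs \<in> words n D \<Longrightarrow> F cs \<subseteq> V"
    "\<And>cs j. cs \<in> words n D \<Longrightarrow> j < n \<Longrightarrow> count_list cs j < card {v\<in>F cs. snd v = j}"
    "\<And>cs m. cs \<in> words n D \<Longrightarrow> supp m \<subseteq> F cs \<Longrightarrow> m \<in> B" by simp_all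
  define u where "u j = int (coldeg m j)" for j
  have u: "\<forall>j<n. 0 \<le> u j" by (simp add: u_def)
  have "covered (F ` words n D) \<inter> mons n V u = B \<inter> mons n V u"
  proof (rule card_seteq)
    show "card (B \<inter> mons n V u) \<le> card (covered (F ` words n D) \<inter> mons n V u)"
      unfolding card[OF u] using card_covered_ge[OF V n F(1,2) u] .
  qed (use F(3) finite_mons[OF V] in \<open>auto simp: covered_def\<close>)
  moreover have "m \<in> B \<inter> mons n V u" using m(1) B(2) by (auto simp: mons_def u_def)
  ultimately obtain cs where "cs \<in> words n D" "supp m \<subseteq> F cs" by (auto simp: covered_def)
  then show ?thesis using F(3) m(2) by (meson subset_trans)
qed

subsection \<open>Leading monomials\<close>

definition var_prime :: "nat \<times> nat \<Rightarrow> nat" where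
  "var_prime v = enumerate {p. prime p} (prod_encode v)"

lemma prime_var_prime: "prime (var_prime v)"
  using enumerate_in_set[OF primes_infinite] by (simp add: var_prime_def)

lemma inj_var_prime: "inj var_prime"
proof (rule injI)
  fix v w assume "var_prime v = var_prime w"
  then have "prod_encode v = prod_encode w"
    unfolding var_prime_def
    using strict_mono_eq[OF strict_mono_enumerate[OF primes_infinite]] by blast
  then show "v = w" by (simp add: prod_encode_eq)
qed

text \<open>Comparing monomials by the integers they become when the variables are replaced by distinct
  primes is a monomial order, and a well-order, by unique factorization.\<close>
definition goedel :: "monom \<Rightarrow> nat" where
  "goedel m = (\<Prod>v\<in>supp m. var_prime v ^ mlookup m v)"

lemma goedel_superset:
  assumes "finite S" "supp m \<subseteq> S"
  shows "goedel m = (\<Prod>v\<in>S. var_prime v ^ mlookup m v)"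
  unfolding goedel_def using assms
  by (intro prod.mono_neutral_left) (auto simp: in_keys_iff)

lemma goedel_add: "goedel (a + b) = goedel a * goedel b"
proof -
  let ?S = "supp a \<union> supp b"
  have "goedel m = (\<Prod>v\<in>?S. var_prime v ^ mlookup m v)" if "supp m \<subseteq> ?S" for m
    using that by (intro goedel_superset) auto
  then show ?thesis
    by (simp add: supp_add lookup_add power_add prod.distrib)
qed

lemma goedel_pos: "0 < goedel m"
  unfolding goedel_def by (intro prod_pos) (simp add: prime_gt_0_nat prime_var_prime)

lemma multiplicity_goedel: "multiplicity (var_prime v) (goedel m) = mlookup m v"
proof -
  have "goedel m = (\<Prod>p\<in>var_prime ` supp m. p ^ mlookup m (inv var_prime p))"
    unfolding goedel_def
    by (simp add: prod.reindex inj_on_subset[OF inj_var_prime] inv_f_f[OF inj_var_prime])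
  also have "multiplicity (var_prime v) \<dots>
      = (if var_prime v \<in> var_prime ` supp m then mlookup m (inv var_prime (var_prime v)) else 0)"
    by (intro multiplicity_prod_prime_powers) (auto simp: prime_var_prime)
  also have "\<dots> = mlookup m v"
    by (simp add: inj_image_mem_iff[OF inj_var_prime] inv_f_f[OF inj_var_prime] in_keys_iff)
  finally show ?thesis .
qed

lemma goedel_inject: "goedel a = goedel b \<longleftrightarrow> a = b"
proof
  assume "goedel a = goedel b"
  then show "a = b" by (intro poly_mapping_eqI) (metis multiplicity_goedel)
qed simp

text \<open>A relation rather than a function, so that the zero polynomial simply has no leading
  monomial.\<close>

definition is_lm :: "'a::field mpoly \<Rightarrow> monom \<Rightarrow> bool" where
  "is_lm p a \<longleftrightarrow> a \<in> Poly_Mapping.keys p \<and> (\<forall>b\<in>Poly_Mapping.keys p. goedel b \<le> goedel a)"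

lemma ex_lm:
  fixes p :: "'a::field mpoly"
  assumes "p \<noteq> 0"
  shows "\<exists>a. is_lm p a"
proof -
  have "finite (goedel ` Poly_Mapping.keys p)" "goedel ` Poly_Mapping.keys p \<noteq> {}"
    using assms by auto
  then obtain a where "a \<in> Poly_Mapping.keys p" "Max (goedel ` Poly_Mapping.keys p) = goedel a"
    using Max_in by blast
  then show ?thesis using Max_ge[of "goedel ` Poly_Mapping.keys p"]
    by (intro exI[of _ a]) (simp add: is_lm_def)
qed

lemma is_lm_single: "c \<noteq> 0 \<Longrightarrow> is_lm (Poly_Mapping.single a c) a"
  by (simp add: is_lm_def)

lemma is_lm_mult:
  fixes p q :: "'a::field mpoly"
  assumes "is_lm p a" "is_lm q b"
  shows "is_lm (p * q) (a + b)"
proof -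
  have le: "goedel m \<le> goedel (a + b)" if m: "m \<in> Poly_Mapping.keys (p * q)" for m
  proof -
    obtain k l where "m = k + l" "k \<in> Poly_Mapping.keys p" "l \<in> Poly_Mapping.keys q"
      using m keys_mult[of p q] by blast
    then show ?thesis using assms by (auto simp: is_lm_def goedel_add intro: mult_mono)
  qed
  \<comment> \<open>Split off the leading terms. Since \<open>goedel\<close> is multiplicative and
    positive, products involving a tail cannot reach the monomial \<open>a + b\<close>, so its
    coefficient is the product of the leading coefficients.\<close>
  define p' where "p' = p - Poly_Mapping.single a (Poly_Mapping.lookup p a)"
  define q' where "q' = q - Poly_Mapping.single b (Poly_Mapping.lookup q b)"
  have p': "goedel k < goedel a" if "k \<in> Poly_Mapping.keys p'" for k
  proof -
    have "k \<noteq> a" "k \<in> Poly_Mapping.keys p"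
      using that by (auto simp: p'_def in_keys_iff lookup_minus lookup_single when_def split: if_splits)
    then show ?thesis using assms(1) goedel_inject[of k a] by (force simp: is_lm_def order_less_le)
  qed
  have q': "goedel k < goedel b" if "k \<in> Poly_Mapping.keys q'" for k
  proof -
    have "k \<noteq> b" "k \<in> Poly_Mapping.keys q"
      using that by (auto simp: q'_def in_keys_iff lookup_minus lookup_single when_def split: if_splits)
    then show ?thesis using assms(2) goedel_inject[of k b] by (force simp: is_lm_def order_less_le)
  qed
  have "a + b \<notin> Poly_Mapping.keys (p' * q)"
  proof
    assume "a + b \<in> Poly_Mapping.keys (p' * q)"
    then obtain k l where kl: "a + b = k + l" "k \<in> Poly_Mapping.keys p'" "l \<in> Poly_Mapping.keys q"
      using keys_mult[of p' q] by blast
    have "goedel k * goedel l < goedel a * goedel b"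
      using p'[OF kl(2)] kl(3) assms(2) goedel_pos[of b]
      by (auto simp: is_lm_def intro: mult_less_le_imp_less goedel_pos)
    then show False using arg_cong[OF kl(1), of goedel] by (simp add: goedel_add)
  qed
  moreover have "a + b \<notin> Poly_Mapping.keys (Poly_Mapping.single a (Poly_Mapping.lookup p a) * q')"
  proof
    assume "a + b \<in> Poly_Mapping.keys (Poly_Mapping.single a (Poly_Mapping.lookup p a) * q')"
    then obtain l where "a + b = a + l" "l \<in> Poly_Mapping.keys q'"
      using keys_mult[of "Poly_Mapping.single a (Poly_Mapping.lookup p a)" q']
      by (auto split: if_splits)
    then show False using q' by fastforce
  qed
  moreover have "p * q = Poly_Mapping.single (a + b) (Poly_Mapping.lookup p a * Poly_Mapping.lookup q b)
      + Poly_Mapping.single a (Poly_Mapping.lookup p a) * q' + p' * q"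
    by (simp add: p'_def q'_def mult_single[symmetric] algebra_simps)
  ultimately have "Poly_Mapping.lookup (p * q) (a + b)
      = Poly_Mapping.lookup p a * Poly_Mapping.lookup q b"
    by (simp add: lookup_add in_keys_iff)
  then show ?thesis using assms le by (simp add: is_lm_def in_keys_iff)
qed

text \<open>Only the inclusion of supports is recorded; this also covers the exponent 0, where
  \<open>b\<close> is the constant monomial.\<close>

lemma is_lm_power:
  fixes p :: "'a::field mpoly"
  assumes "is_lm p a"
  shows "\<exists>b. is_lm (p ^ k) b \<and> supp b \<subseteq> supp a"
proof (induction k)
  case 0
  have "is_lm (1 :: 'a mpoly) 0" by (simp add: is_lm_def)
  then show ?case by (intro exI[of _ 0]) simp
next
  case (Suc k)
  then show ?case using is_lm_mult[OF assms] by (fastforce simp: supp_add)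
qed

text \<open>Every monomial has positive height, so only the zero polynomial has height \<open>0\<close>.\<close>
definition height :: "'a::field mpoly \<Rightarrow> nat" where
  "height p = Max (insert 0 (goedel ` Poly_Mapping.keys p))"

text \<open>One division step: the quotient of the leading coefficients cancels \<open>a\<close>,
  and every remaining monomial is smaller.\<close>

lemma height_reduce:
  fixes f p :: "'a::field mpoly"
  assumes "is_lm f a" "is_lm p a"
  shows "\<exists>c. height (f - pscale c p) < height f"
proof -
  define c where "c = Poly_Mapping.lookup f a / Poly_Mapping.lookup p a"
  define g where "g = f - pscale c p"
  have g: "Poly_Mapping.lookup g b = Poly_Mapping.lookup f b - c * Poly_Mapping.lookup p b" for b
    by (simp add: g_def pscale_def lookup_minus Poly_Mapping.map.rep_eq when_def)
  have "goedel b < goedel a" if b: "b \<in> Poly_Mapping.keys g" for b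
  proof -
    have "b \<noteq> a" using b assms(2) by (auto simp: in_keys_iff g c_def is_lm_def)
    moreover have "b \<in> Poly_Mapping.keys f \<or> b \<in> Poly_Mapping.keys p"
      using b by (auto simp: in_keys_iff g)
    ultimately show ?thesis using assms goedel_inject[of b a]
      by (force simp: is_lm_def order_less_le)
  qed
  then have "height g < goedel a" by (simp add: height_def goedel_pos)
  also have "goedel a \<le> height f"
    using assms(1) by (auto simp: height_def is_lm_def intro!: Max_ge)
  finally show ?thesis unfolding g_def by blast
qed

subsection \<open>Dimensions\<close>

lemma pscale_conv_mult: "pscale c p = Poly_Mapping.single 0 c * p"
  by (simp add: pscale_def mult_map_scale_conv_mult)

text \<open>Makes linear algebra available for the \<open>vector_space.dim pscale\<close> in
  \<open>quot_dim\<close>.\<close>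

interpretation mpoly: vector_space "pscale :: 'a::field \<Rightarrow> 'a mpoly \<Rightarrow> 'a mpoly"
  by unfold_locales
    (simp_all add: pscale_conv_mult single_add mult_single[symmetric] algebra_simps,
     simp_all add: mult_single flip: mult.assoc)

lemma lookup_pscale: "Poly_Mapping.lookup (pscale c p) m = c * Poly_Mapping.lookup p m"
  by (simp add: pscale_def Poly_Mapping.map.rep_eq when_def)

text \<open>One element of \<open>W\<close> for each leading monomial gives a basis: distinct
  leading monomials force independence, and repeated division by these elements, by induction on
  \<open>height\<close>, shows that they span.\<close>

lemma dim_eq_card_lm:
  fixes W :: "'a::field mpoly set"
  assumes W: "mpoly.subspace W" and E: "finite E" "\<And>p. p \<in> W \<Longrightarrow> Poly_Mapping.keys p \<subseteq> E"
  shows "mpoly.dim W = card {a. \<exists>p\<in>W. is_lm p a}"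
proof -
  define L where "L = {a. \<exists>p\<in>W. is_lm p a}"
  have "\<forall>a\<in>L. \<exists>p\<in>W. is_lm p a" by (auto simp: L_def)
  then obtain g where g: "\<And>a. a \<in> L \<Longrightarrow> g a \<in> W" "\<And>a. a \<in> L \<Longrightarrow> is_lm (g a) a" by metis
  have "L \<subseteq> E" using E(2) by (auto simp: L_def is_lm_def)
  then have finL: "finite L" using E(1) finite_subset by blast
  have inj: "inj_on g L"
  proof (rule inj_onI)
    fix a b assume "a \<in> L" "b \<in> L" "g a = g b"
    then have "goedel a = goedel b"
      using g(2)[of a] g(2)[of b] by (intro antisym) (auto simp: is_lm_def)
    then show "a = b" by (simp add: goedel_inject)
  qed
  have "mpoly.independent (g ` L)"
  proof (rule mpoly.independent_if_scalars_zero)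
    fix c x assume sum: "(\<Sum>y\<in>g ` L. pscale (c y) y) = 0" and x: "x \<in> g ` L"
    show "c x = 0"
    proof (rule ccontr)
      assume "c x \<noteq> 0"
      let ?N = "{a\<in>L. c (g a) \<noteq> 0}"
      have N: "finite (goedel ` ?N)" "goedel ` ?N \<noteq> {}" using finL x \<open>c x \<noteq> 0\<close> by auto
      \<comment> \<open>The largest leading monomial with a nonzero scalar occurs in no other
        summand with nonzero scalar, so it cannot cancel.\<close>
      obtain a where a: "a \<in> L" "c (g a) \<noteq> 0" "\<And>b. b \<in> ?N \<Longrightarrow> goedel b \<le> goedel a"
      proof -
        obtain a where "a \<in> ?N" "Max (goedel ` ?N) = goedel a" using Max_in[OF N] by blast
        then show thesis using that[of a] Max_ge[OF N(1)] by simp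
      qed
      have other: "c (g b) * Poly_Mapping.lookup (g b) a = 0" if b: "b \<in> L" "b \<noteq> a" for b
      proof (rule ccontr)
        assume n: "c (g b) * Poly_Mapping.lookup (g b) a \<noteq> 0"
        then have "goedel b \<le> goedel a" using a(3) b(1) by auto
        moreover have "goedel a \<le> goedel b"
          using n g(2)[OF b(1)] by (auto simp: is_lm_def in_keys_iff)
        ultimately show False using b(2) goedel_inject[of a b] by simp
      qed
      have "0 = Poly_Mapping.lookup (\<Sum>b\<in>L. pscale (c (g b)) (g b)) a"
        using sum by (simp add: sum.reindex[OF inj])
      also have "\<dots> = (\<Sum>b\<in>L. c (g b) * Poly_Mapping.lookup (g b) a)"
        by (simp add: lookup_sum lookup_pscale)
      also have "\<dots> = c (g a) * Poly_Mapping.lookup (g a) a"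
      proof -
        have "(\<Sum>b\<in>L - {a}. c (g b) * Poly_Mapping.lookup (g b) a) = 0"
          using other by (intro sum.neutral) blast
        then show ?thesis using finL a(1) by (simp add: sum.remove[of L a])
      qed
      finally show False using a(2) g(2)[OF a(1)] by (simp add: is_lm_def in_keys_iff)
    qed
  qed (use finL in simp)
  moreover have "p \<in> mpoly.span (g ` L)" if "p \<in> W" for p
    using that
  proof (induction "height p" arbitrary: p rule: less_induct)
    case less
    show ?case
    proof (cases "p = 0")
      case False
      then obtain a where a: "is_lm p a" using ex_lm by blast
      then have L: "a \<in> L" using less.prems by (auto simp: L_def)
      obtain c where c: "height (p - pscale c (g a)) < height p"
        using height_reduce[OF a g(2)[OF L]] by blast
      have "p - pscale c (g a) \<in> mpoly.span (g ` L)"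
        using less.prems W g(1)[OF L]
        by (intro less.hyps c) (simp add: mpoly.subspace_diff mpoly.subspace_scale)
      moreover have "pscale c (g a) \<in> mpoly.span (g ` L)"
        using L by (intro mpoly.span_scale mpoly.span_base) simp
      ultimately show ?thesis by (metis mpoly.span_add diff_add_cancel)
    qed (simp add: mpoly.span_zero)
  qed
  ultimately have "mpoly.dim W = card (g ` L)"
    using g(1) by (intro mpoly.dim_unique) auto
  then show ?thesis using card_image[OF inj] by (simp add: L_def)
qed

subsection \<open>Points of the multigraded Hilbert scheme\<close>

abbreviation grid :: "nat \<Rightarrow> nat \<Rightarrow> (nat \<times> nat) set" where
  "grid d n \<equiv> {..<d} \<times> {..<n}"

lemma polyring_conv: "p \<in> polyring d n \<longleftrightarrow> (\<forall>m\<in>Poly_Mapping.keys p. supp m \<subseteq> grid d n)"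
  by (simp add: polyring_def subset_eq mem_Times_iff)

lemma polyring_single: "supp m \<subseteq> grid d n \<Longrightarrow> Poly_Mapping.single m c \<in> polyring d n"
  by (simp add: polyring_conv)

lemma polyring_mult: "p \<in> polyring d n \<Longrightarrow> q \<in> polyring d n \<Longrightarrow> p * q \<in> polyring d n"
  unfolding polyring_conv
proof
  fix m assume pq: "\<forall>m\<in>Poly_Mapping.keys p. supp m \<subseteq> grid d n"
    "\<forall>m\<in>Poly_Mapping.keys q. supp m \<subseteq> grid d n" and "m \<in> Poly_Mapping.keys (p * q)"
  then obtain k l where "m = k + l" "k \<in> Poly_Mapping.keys p" "l \<in> Poly_Mapping.keys q"
    using keys_mult[of p q] by blast
  with pq show "supp m \<subseteq> grid d n" by (simp add: supp_add)
qed

lemma polyring_keys: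
  assumes "p \<in> polyring d n" "q \<in> polyring d n"
    and "Poly_Mapping.keys r \<subseteq> Poly_Mapping.keys p \<union> Poly_Mapping.keys q"
  shows "r \<in> polyring d n"
  using assms unfolding polyring_def by blast

lemma polyring_add: "p \<in> polyring d n \<Longrightarrow> q \<in> polyring d n \<Longrightarrow> p + q \<in> polyring d n"
  by (erule (1) polyring_keys) (rule keys_add)

lemma polyring_diff:
  assumes "p \<in> polyring d n" "q \<in> polyring d n"
  shows "p - q \<in> polyring d n"
  using assms by (rule polyring_keys) (auto simp: in_keys_iff lookup_minus)

lemma polyring_power: "p \<in> polyring d n \<Longrightarrow> p ^ k \<in> polyring d n"
proof (induction k)
  case 0
  then show ?case by (simp add: polyring_conv)
qed (simp add: polyring_mult)

lemma graded_piece_conv: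
  "graded_piece d n u = {p. Poly_Mapping.keys p \<subseteq> mons n (grid d n) (\<lambda>j. int (u j))}"
  unfolding graded_piece_def polyring_conv mons_def of_nat_eq_iff by blast

lemma lookup_hcomp:
  "Poly_Mapping.lookup (hcomp n u p) m = (if \<forall>j<n. coldeg m j = u j then Poly_Mapping.lookup p m else 0)"
proof -
  have "finite {m. (if \<forall>j<n. coldeg m j = u j then Poly_Mapping.lookup p m else 0) \<noteq> 0}"
    by (rule finite_subset[of _ "Poly_Mapping.keys p"]) (auto simp: in_keys_iff)
  then show ?thesis by (simp add: hcomp_def)
qed

lemma ideal_scale:
  fixes I :: "'a::field mpoly set"
  assumes "is_ideal d n I" "f \<in> I"
  shows "pscale c f \<in> I"
proof -
  have "Poly_Mapping.single 0 c \<in> polyring d n" by (intro polyring_single) simp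
  then show ?thesis using assms unfolding is_ideal_def pscale_conv_mult by blast
qed

lemma ideal_subspace:
  fixes I :: "'a::field mpoly set"
  assumes "is_ideal d n I"
  shows "mpoly.subspace (I \<inter> graded_piece d n u)"
proof (rule mpoly.subspaceI)
  fix f g :: "'a mpoly" and c
  assume f: "f \<in> I \<inter> graded_piece d n u"
  have "Poly_Mapping.keys (pscale c f) \<subseteq> Poly_Mapping.keys f"
    by (auto simp: in_keys_iff lookup_pscale)
  then show "pscale c f \<in> I \<inter> graded_piece d n u"
    using f ideal_scale[OF assms, of f c] unfolding graded_piece_conv by blast
  assume g: "g \<in> I \<inter> graded_piece d n u"
  then have "f + g \<in> I" using f assms by (simp add: is_ideal_def)
  then show "f + g \<in> I \<inter> graded_piece d n u"
    using f g keys_add[of f g] unfolding graded_piece_conv by blast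
qed (use assms in \<open>simp add: is_ideal_def graded_piece_conv\<close>)

text \<open>Lets \<open>ideal_subspace\<close> apply to a full graded piece as well.\<close>

lemma ideal_polyring: "is_ideal d n (polyring d n :: 'a::field mpoly set)"
proof -
  have "0 \<in> (polyring d n :: 'a mpoly set)" by (simp add: polyring_def)
  then show ?thesis by (simp add: is_ideal_def polyring_add polyring_mult)
qed

text \<open>The monomials of the ring outside the initial ideal of \<open>I\<close>.\<close>

definition standard :: "nat \<Rightarrow> nat \<Rightarrow> 'a::field mpoly set \<Rightarrow> monom set" where
  "standard d n I = {m. supp m \<subseteq> grid d n \<and> \<not> (\<exists>p\<in>I. is_lm p m)}"

lemma order_ideal_standard:
  fixes I :: "'a::field mpoly set"
  assumes "is_ideal d n I"
  shows "order_ideal (standard d n I)"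
  unfolding order_ideal_def
proof (intro allI impI)
  fix m k assume mk: "m + k \<in> standard d n I"
  have False if p: "p \<in> I" "is_lm p m" for p
  proof -
    let ?x = "Poly_Mapping.single k (1 :: 'a)"
    have "?x \<in> polyring d n" using mk by (intro polyring_single) (auto simp: standard_def supp_add)
    then have "?x * p \<in> I" using assms p(1) by (simp add: is_ideal_def)
    moreover have "is_lm (?x * p) (m + k)"
      using is_lm_mult[OF is_lm_single p(2), of 1 k] by (simp add: add.commute)
    ultimately show False using mk by (auto simp: standard_def)
  qed
  then show "m \<in> standard d n I" using mk by (auto simp: standard_def supp_add)
qed

text \<open>Macaulay's basis theorem in each degree, by counting leading monomials of the full
  graded piece and of its part in \<open>I\<close>.\<close>

lemma quot_dim_eq_card_standard:
  fixes I :: "'a::field mpoly set"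
  assumes I: "is_ideal d n I" "is_multihomogeneous n I"
  shows "quot_dim d n I u = card (standard d n I \<inter> mons n (grid d n) (\<lambda>j. int (u j)))"
proof -
  let ?M = "mons n (grid d n) (\<lambda>j. int (u j))"
  have fin: "finite ?M" by (intro finite_mons) auto
  have "mpoly.dim (graded_piece d n u :: 'a mpoly set)
      = card {a. \<exists>p\<in>(graded_piece d n u :: 'a mpoly set). is_lm p a}"
  proof (rule dim_eq_card_lm[OF _ fin])
    have "polyring d n \<inter> graded_piece d n u = (graded_piece d n u :: 'a mpoly set)"
      by (auto simp: graded_piece_def)
    then show "mpoly.subspace (graded_piece d n u :: 'a mpoly set)"
      using ideal_subspace[OF ideal_polyring, of d n u] by metis
  qed (auto simp: graded_piece_conv)
  also have "{a. \<exists>p\<in>(graded_piece d n u :: 'a mpoly set). is_lm p a} = ?M"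
  proof (intro equalityI subsetI)
    fix m assume "m \<in> ?M"
    then show "m \<in> {a. \<exists>p\<in>(graded_piece d n u :: 'a mpoly set). is_lm p a}"
      using is_lm_single[of "1 :: 'a" m]
      by (auto simp: graded_piece_conv intro!: exI[of _ "Poly_Mapping.single m 1"])
  qed (auto simp: graded_piece_conv is_lm_def)
  finally have 1: "mpoly.dim (graded_piece d n u :: 'a mpoly set) = card ?M" .
  have "mpoly.dim (I \<inter> graded_piece d n u) = card {a. \<exists>p\<in>I \<inter> graded_piece d n u. is_lm p a}"
    by (intro dim_eq_card_lm[OF ideal_subspace[OF I(1)] fin]) (auto simp: graded_piece_conv)
  also have "{a. \<exists>p\<in>I \<inter> graded_piece d n u. is_lm p a} = ?M - standard d n I"
  proof (intro equalityI subsetI)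
    fix a assume "a \<in> ?M - standard d n I"
    then obtain p where p: "p \<in> I" "is_lm p a" and a: "a \<in> ?M"
      by (auto simp: standard_def mons_def)
    \<comment> \<open>Homogeneity enters here: the component of \<open>p\<close> in the degree of
      \<open>a\<close> stays in \<open>I\<close> and keeps \<open>a\<close> as leading
      monomial.\<close>
    have "hcomp n u p \<in> I" using I(2) p(1) by (simp add: is_multihomogeneous_def)
    moreover have "hcomp n u p \<in> graded_piece d n u"
    proof -
      have "Poly_Mapping.keys (hcomp n u p) \<subseteq> Poly_Mapping.keys p"
        by (auto simp: in_keys_iff lookup_hcomp split: if_splits)
      moreover have "p \<in> polyring d n" using I(1) p(1) by (auto simp: is_ideal_def)
      ultimately have "hcomp n u p \<in> polyring d n" unfolding polyring_conv by blast
      then show ?thesis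
        by (auto simp: graded_piece_def in_keys_iff lookup_hcomp split: if_splits)
    qed
    moreover have "is_lm (hcomp n u p) a"
      using p(2) a by (auto simp: is_lm_def in_keys_iff lookup_hcomp mons_def split: if_splits)
    ultimately show "a \<in> {a. \<exists>p\<in>I \<inter> graded_piece d n u. is_lm p a}" by blast
  qed (auto simp: graded_piece_conv is_lm_def standard_def)
  finally have "mpoly.dim (I \<inter> graded_piece d n u) = card (?M - standard d n I)" .
  then have "quot_dim d n I u = card ?M - card (?M - standard d n I)"
    unfolding quot_dim_def 1 by simp
  also have "\<dots> = card (standard d n I \<inter> ?M)"
    using fin by (simp add: card_Diff_subset_Int Int_commute card_mono)
  finally show ?thesis .
qed

text \<open>The leading monomial of \<open>f ^ k\<close> is not standard and its support lies in
  that of the leading monomial of \<open>f\<close>, so the latter is not standard either. Hence an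
  element of \<open>I\<close> reduces \<open>f\<close>, and induction on \<open>height\<close>
  applies.\<close>

lemma is_radical_if_support_determined:
  fixes I :: "'a::field mpoly set"
  assumes I: "is_ideal d n I"
    and supp: "\<And>m m'. m \<in> standard d n I \<Longrightarrow> supp m' \<subseteq> supp m \<Longrightarrow> m' \<in> standard d n I"
  shows "is_radical d n I"
proof -
  have ring: "p * f \<in> I" if "f \<in> I" "p \<in> polyring d n" for f p
    using that I unfolding is_ideal_def by blast
  have add: "f + g \<in> I" if "f \<in> I" "g \<in> I" for f g
    using that I unfolding is_ideal_def by blast
  have diff: "f - g \<in> I" if fg: "f \<in> I" "g \<in> I" for f g
    using add[OF fg(1) ideal_scale[OF I fg(2), of "- 1"]] by (simp add: pscale_conv_mult single_uminus)
  have polyring: "f \<in> polyring d n" if "f \<in> I" for f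
    using that I unfolding is_ideal_def by blast
  \<comment> \<open>Modulo \<open>I\<close> the power depends only on the class of \<open>f\<close>,
    so the hypothesis on \<open>f ^ k\<close> survives a reduction step.\<close>
  have power_diff: "(f - g) ^ k - f ^ k \<in> I" if f: "f \<in> polyring d n" and g: "g \<in> I" for f g k
  proof (induction k)
    case 0
    then show ?case using I by (simp add: is_ideal_def)
  next
    case (Suc k)
    have e: "(f - g) ^ Suc k - f ^ Suc k = (f - g) * ((f - g) ^ k - f ^ k) - f ^ k * g"
      by (simp add: algebra_simps)
    have "(f - g) * ((f - g) ^ k - f ^ k) \<in> I"
      using Suc by (rule ring) (intro polyring_diff f polyring[OF g])
    moreover have "f ^ k * g \<in> I" using g by (rule ring) (intro polyring_power f)
    ultimately show ?case unfolding e by (rule diff)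
  qed
  have "f \<in> I" if "f \<in> polyring d n" "f ^ k \<in> I" for f k
    using that
  proof (induction "height f" arbitrary: f rule: less_induct)
    case less
    show ?case
    proof (cases "f = 0")
      case False
      then obtain a where a: "is_lm f a" using ex_lm by blast
      obtain b where b: "is_lm (f ^ k) b" "supp b \<subseteq> supp a" using is_lm_power[OF a] by blast
      have "b \<notin> standard d n I" using b(1) less.prems(2) by (auto simp: standard_def)
      then have "a \<notin> standard d n I" using supp b(2) by blast
      moreover have "supp a \<subseteq> grid d n" using a less.prems(1) by (auto simp: polyring_conv is_lm_def)
      ultimately obtain p where p: "p \<in> I" "is_lm p a" by (auto simp: standard_def)
      obtain c where c: "height (f - pscale c p) < height f" using height_reduce[OF a p(2)] by blast
      have cp: "pscale c p \<in> I" using ideal_scale[OF I p(1)] .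
      have "(f - pscale c p) ^ k \<in> I"
        using add[OF power_diff[OF less.prems(1) cp, of k] less.prems(2)] by simp
      then have "f - pscale c p \<in> I"
        by (rule less.hyps[OF c polyring_diff[OF less.prems(1) polyring[OF cp]]])
      from add[OF this cp] show ?thesis by simp
    qed (use I in \<open>simp add: is_ideal_def\<close>)
  qed
  then show ?thesis by (auto simp: is_radical_def)
qed

theorem theorem2p1:
  fixes I :: "('a::field) mpoly set" and d n :: nat
  assumes "d \<ge> 1" and "n \<ge> 1" and "in_Hilb d n I"
  shows "is_radical d n I"
proof -
  have I: "is_ideal d n I" "is_multihomogeneous n I"
    "\<And>u. quot_dim d n I u = ((\<Sum>j<n. u j) + d - 1) choose (d - 1)"
    using assms(3) unfolding in_Hilb_def by simp_all
  have card: "card (standard d n I \<inter> mons n (grid d n) u) = (nat (\<Sum>j<n. u j) + (d - 1)) choose (d - 1)"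
    if u: "\<forall>j<n. 0 \<le> u j" for u
  proof -
    \<comment> \<open>The Hilbert function is prescribed for natural degrees, while the
      combinatorial part uses nonnegative integer degrees.\<close>
    have "mons n (grid d n) u = mons n (grid d n) (\<lambda>j. int (nat (u j)))"
      using u by (auto simp: mons_def)
    moreover have "(\<Sum>j<n. nat (u j)) = nat (\<Sum>j<n. u j)"
    proof -
      have "int (\<Sum>j<n. nat (u j)) = (\<Sum>j<n. u j)" using u by simp
      then show ?thesis by linarith
    qed
    ultimately show ?thesis
      using I(3)[of "\<lambda>j. nat (u j)"] quot_dim_eq_card_standard[OF I(1,2), of "\<lambda>j. nat (u j)"] assms(1)
      by simp
  qed
  show ?thesis
  proof (rule is_radical_if_support_determined[OF I(1)])
    fix m m' assume m: "m \<in> standard d n I" "supp m' \<subseteq> supp m"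
    have grid: "finite (grid d n)" "snd ` grid d n \<subseteq> {..<n}" by auto
    have supp: "supp m \<subseteq> grid d n" if "m \<in> standard d n I" for m
      using that by (simp add: standard_def)
    show "m' \<in> standard d n I"
      using order_ideal_support_determined[OF grid _ order_ideal_standard[OF I(1)] supp card m] assms(2)
      by simp
  qed
qed

end
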